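(* Let $\alpha$ be a non-zero rational number and let $t\in[1,\infty]$. Then the infimum in $M_t(\alpha)$ is attained in $\mathbb{Q}$; that is, there exist $N\in\mathbb{N}$ and non-zero rational numbers $\alpha_1,\ldots,\alpha_N$ with $\alpha=\alpha_1\cdots\alpha_N$ such that $M_t(\alpha)=\left(\sum_{n=1}^N M(\alpha_n)^t\right)^{1/t}$ if $t<\infty$, and $M_\infty(\alpha)=\max_{1\le n\le N} M(\alpha_n)$ if $t=\infty$.
   Context: For a polynomial $f(z)=a\prod_{n=1}^N(z-\beta_n)\in\mathbb{C}[z]$, its (logarithmic) Mahler measure is $M(f)=\log|a|+\sum_{n=1}^N\log^+|\beta_n|$, where $\log^+x=\max\{0,\log x\}$. For a non-zero algebraic number $\beta$, $M(\beta)$ is the Mahler measure of the minimal polynomial of $\beta$ over $\mathbb{Z}$. For $t\in[1,\infty)$ and $\beta\in\overline{\mathbb{Q}}^\times$, the $t$-metric Mahler measure is $M_t(\beta)=\inf\{(\sum_{n=1}^N M(\beta_n)^t)^{1/t}: N\in\mathbb{N},\ \beta_n\in\overline{\mathbb{Q}}^\times,\ \beta=\prod_{n=1}^N\beta_n\}$, and $M_\infty(\beta)=\inf\{\max_{1\le n\le N}M(\beta_n): N\in\mathbb{N},\ \beta_n\in\overline{\mathbb{Q}}^\times,\ \beta=\prod_{n=1}^N\beta_n\}$. For a subset $S\subseteq\overline{\mathbb{Q}}$, the infimum in $M_t(\beta)$ is said to be attained in $S$ if there are $\beta_1,\ldots,\beta_N\in S$ with $\beta=\beta_1\cdots\beta_N$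 for which the expression inside the infimum equals $M_t(\beta)$. *)

theory Defs
  imports "HOL-Computational_Algebra.Computational_Algebra" "HOL-Library.Extended_Real"
begin

text \<open>The maximum with 0 also gives the intended value \<open>0\<close> at \<open>0\<close>, since \<open>ln 0 = 0\<close> here.\<close>

definition ln_plus :: "real \<Rightarrow> real" where
  "ln_plus x = max 0 (ln x)"

text \<open>\<^const>\<open>proots\<close> is the multiset of roots, so roots count with multiplicity. The value at
  the zero polynomial is meaningless.\<close>

definition mahler_poly :: "complex poly \<Rightarrow> real" where
  "mahler_poly f = ln (cmod (lead_coeff f)) + (\<Sum>\<beta>\<in>#proots f. ln_plus (cmod \<beta>))"

text \<open>An irreducible element of \<open>\<int>[X]\<close> with a root is non-constant, hence primitive; the sign
  condition on the leading coefficient selects one of the two associates. Existence and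
  uniqueness for algebraic \<open>\<beta>\<close> are shown below.\<close>

definition is_min_int_poly :: "complex \<Rightarrow> int poly \<Rightarrow> bool" where
  "is_min_int_poly \<beta> p \<longleftrightarrow>
     irreducible p \<and> lead_coeff p > 0 \<and> poly (map_poly of_int p) \<beta> = 0"

definition min_int_poly :: "complex \<Rightarrow> int poly" where
  "min_int_poly \<beta> = (THE p. is_min_int_poly \<beta> p)"

definition mahler :: "complex \<Rightarrow> real" where
  "mahler \<beta> = mahler_poly (map_poly of_int (min_int_poly \<beta>))"

definition is_factorization :: "complex \<Rightarrow> nat \<Rightarrow> (nat \<Rightarrow> complex) \<Rightarrow> bool" where
  "is_factorization \<beta> N b \<longleftrightarrow>
     N \<ge> 1 \<and> (\<forall>n\<in>{1..N}. algebraic (b n) \<and> b n \<noteq> 0) \<and> \<beta> = (\<Prod>n=1..N. b n)"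

definition metric_mahler_real :: "real \<Rightarrow> complex \<Rightarrow> real" where
  "metric_mahler_real t \<beta> =
     Inf {(\<Sum>n=1..N. mahler (b n) powr t) powr (1 / t) | N b. is_factorization \<beta> N b}"

definition metric_mahler_infinity :: "complex \<Rightarrow> real" where
  "metric_mahler_infinity \<beta> =
     Inf {Max ((\<lambda>n. mahler (b n)) ` {1..N}) | N b. is_factorization \<beta> N b}"

definition metric_mahler :: "ereal \<Rightarrow> complex \<Rightarrow> real" where
  "metric_mahler t \<beta> =
     (if t = \<infinity> then metric_mahler_infinity \<beta> else metric_mahler_real (real_of_ereal t) \<beta>)"

lemma poly_of_int_mult:
  "poly (map_poly of_int (p * q)) x = poly (map_poly of_int p) x * poly (map_poly of_int q) (x::complex)"
proof -
  have "map_poly of_int (p * q) = map_poly of_int p * (map_poly of_int q :: complex poly)"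
    by (intro poly_eqI) (simp add: coeff_map_poly coeff_mult)
  then show ?thesis by simp
qed

lemma poly_of_int_add:
  "poly (map_poly of_int (p + q)) x = poly (map_poly of_int p) x + poly (map_poly of_int q) (x::complex)"
proof -
  have "map_poly of_int (p + q) = map_poly of_int p + (map_poly of_int q :: complex poly)"
    by (intro poly_eqI) (simp add: coeff_map_poly)
  then show ?thesis by simp
qed

lemma irreducible_factor_with_root:
  fixes p :: "int poly" and x :: complex
  assumes "p \<noteq> 0" and "poly (map_poly of_int p) x = 0"
  shows "\<exists>q. irreducible q \<and> q dvd p \<and> poly (map_poly of_int q) x = 0"
  using assms
proof (induction p rule: prime_divisors_induct)
  case zero
  then show ?case by simp
next
  case (unit u)
  then obtain c where "u = [:c:]" "c \<noteq> 0"
    by (auto simp: is_unit_poly_iff)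
  with unit show ?case by (simp add: map_poly_pCons)
next
  case (factor p q)
  show ?case
  proof (cases "poly (map_poly of_int p) x = 0")
    case True
    then show ?thesis using factor by (intro exI[of _ p]) (simp add: prime_elem_imp_irreducible)
  next
    case False
    then have "poly (map_poly of_int q) x = 0" using factor by (simp add: poly_of_int_mult)
    then obtain r where "irreducible r" "r dvd q" "poly (map_poly of_int r) x = 0"
      using factor by auto
    then show ?thesis by (auto intro: dvd_mult)
  qed
qed

lemma ex1_is_min_int_poly:
  assumes "algebraic \<beta>"
  shows "\<exists>!p. is_min_int_poly \<beta> p"
proof -
  let ?root = "\<lambda>p::int poly. poly (map_poly of_int p) \<beta> = 0"
  obtain p0 where "p0 \<noteq> 0" "?root p0"
    using assms by (elim algebraicE')
  then obtain q0 where "irreducible q0" "?root q0"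
    using irreducible_factor_with_root by blast
  then obtain g where g: "irreducible g" "?root g"
    and g_min: "\<And>q. irreducible q \<Longrightarrow> ?root q \<Longrightarrow> degree g \<le> degree q"
    using ex_has_least_nat[of "\<lambda>q. irreducible q \<and> ?root q" q0 degree] by blast
  have g0: "g \<noteq> 0" using g by auto
  have deg_g: "degree g > 0"
  proof (rule ccontr)
    assume "\<not> degree g > 0"
    then obtain c where "g = [:c:]" by (auto elim: degree_eq_zeroE)
    with g g0 show False by (simp add: map_poly_pCons)
  qed
  have g_dvd: "g dvd p" if p: "?root p" for p
  proof -
    obtain q r where qr: "pseudo_divmod p g = (q, r)" by fastforce
    define c where "c = lead_coeff g ^ (Suc (degree p) - degree g)"
    have eq: "smult c p = g * q + r" and deg: "r = 0 \<or> degree r < degree g"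
      using pseudo_divmod[OF g0 qr] by (auto simp: c_def)
    have c0: "c \<noteq> 0" using g0 by (simp add: c_def)
    have "[:c:] * p = g * q + r" using eq by simp
    then have "poly (map_poly of_int ([:c:] * p)) \<beta> = poly (map_poly of_int (g * q + r)) \<beta>" by metis
    then have "?root r" using g p unfolding poly_of_int_mult poly_of_int_add by simp
    have "r = 0"
    proof (rule ccontr)
      assume r: "r \<noteq> 0"
      then obtain s where s: "irreducible s" "s dvd r" "?root s"
        using irreducible_factor_with_root \<open>?root r\<close> by blast
      have "degree s \<le> degree r" using s r dvd_imp_degree_le by blast
      with g_min[of s] s deg r show False by auto
    qed
    then have "g dvd [:c:] * p" using eq by simp
    moreover have "\<not> g dvd [:c:]"
      using dvd_imp_degree_le[of g "[:c:]"] c0 deg_g by auto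
    ultimately show ?thesis
      using g(1) irreducible_imp_prime_elem prime_elem_dvd_mult_iff by blast
  qed
  define p where "p = (if lead_coeff g > 0 then g else - g)"
  have "poly (map_poly of_int ([:-1:] * g)) \<beta> = 0"
    unfolding poly_of_int_mult using g by simp
  then have "?root p" using g by (auto simp: p_def)
  moreover have "lead_coeff p > 0"
    using g0 leading_coeff_0_iff[of g] by (auto simp: p_def simp del: leading_coeff_0_iff)
  moreover have "irreducible p"
    using g(1) irreducible_mult_unit_left[of "-1" g] by (auto simp: p_def)
  ultimately have ex: "is_min_int_poly \<beta> p" by (simp add: is_min_int_poly_def)
  have "q = p" if q: "is_min_int_poly \<beta> q" for q
  proof -
    have "p dvd q" using g_dvd[of q] q by (auto simp: p_def is_min_int_poly_def)
    then obtain u where u: "q = p * u" by auto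
    moreover have "\<not> is_unit p" using ex by (auto simp: is_min_int_poly_def irreducible_def)
    ultimately have "is_unit u" using q by (auto simp: is_min_int_poly_def irreducible_def)
    then obtain c where c: "u = [:c:]" "is_unit c" by (auto simp: is_unit_poly_iff)
    then have "lead_coeff q = lead_coeff p * c" using u by (simp add: lead_coeff_mult)
    then have "c > 0" using q ex by (simp add: is_min_int_poly_def zero_less_mult_iff)
    then have "c = 1" using c by auto
    then show ?thesis using u c by simp
  qed
  with ex show ?thesis by blast
qed

lemma min_int_poly: "algebraic \<beta> \<Longrightarrow> is_min_int_poly \<beta> (min_int_poly \<beta>)"
  unfolding min_int_poly_def by (rule theI') (rule ex1_is_min_int_poly)

end

theory Submission
  imports Defs "Jordan_Normal_Form.Char_Poly"
begin

text \<open>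
  Write \<open>\<alpha> = \<plusminus> a / b\<close> in lowest terms and let \<open>\<alpha> = \<beta>\<^sub>1 \<cdots> \<beta>\<^sub>N\<close> with algebraic \<open>\<beta>\<^sub>n\<close>. If \<open>l\<^sub>n\<close> and
  \<open>c\<^sub>n\<close> are the leading and constant coefficients of the minimal polynomial of \<open>\<beta>\<^sub>n\<close> over \<open>\<int>\<close>, then
  \<open>l\<^sub>n \<beta>\<^sub>n\<close> and \<open>c\<^sub>n / \<beta>\<^sub>n\<close> are algebraic integers. Multiplying over \<open>n\<close>, the rational numbers
  \<open>\<alpha> \<Prod> l\<^sub>n\<close> and \<open>\<alpha>\<^sup>-\<^sup>1 \<Prod> c\<^sub>n\<close> are integers, so \<open>b\<close> divides \<open>\<Prod> l\<^sub>n\<close> and \<open>a\<close> divides \<open>\<Prod> c\<^sub>n\<close>. Hence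
  \<open>a = \<Prod> x\<^sub>n\<close> and \<open>b = \<Prod> y\<^sub>n\<close> with \<open>x\<^sub>n\<close> dividing \<open>c\<^sub>n\<close> and \<open>y\<^sub>n\<close> dividing \<open>l\<^sub>n\<close>, and the Mahler measure
  \<open>log (max x\<^sub>n y\<^sub>n)\<close> of \<open>x\<^sub>n / y\<^sub>n\<close> is at most \<open>log (max \<bar>c\<^sub>n\<bar> \<bar>l\<^sub>n\<bar>) \<le> M(\<beta>\<^sub>n)\<close>. So only the rational
  factorizations \<open>\<alpha> = \<plusminus> \<Prod> x\<^sub>n / y\<^sub>n\<close> matter. In each of them at most \<open>a + b\<close> factors differ from \<open>\<plusminus> 1\<close>,
  so they yield only finitely many values and the infimum is a minimum.
\<close>

section \<open>Algebraic integers are closed under products\<close>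

text \<open>The complex numbers as a module over the integers, so that
  \<open>int_span.span S\<close> is the additive subgroup generated by \<open>S\<close>.\<close>

interpretation int_span: Modules.module "\<lambda>(c::int) (x::complex). of_int c * x"
  by unfold_locales (simp_all add: algebra_simps)

text \<open>The determinant trick: on the vector of elements of \<open>S\<close>, multiplication by
  \<open>x\<close> acts as an integer matrix. The vector is nonzero because of \<open>s0\<close>, so
  \<open>x\<close> is an eigenvalue and a root of the characteristic polynomial, which is monic over
  the integers.\<close>

lemma algebraic_int_if_int_span_stable:
  assumes fin: "finite S" and nz: "s0 \<in> S" "s0 \<noteq> 0"
    and stable: "\<And>s. s \<in> S \<Longrightarrow> x * s \<in> int_span.span S"
  shows "algebraic_int (x::complex)"
proof -
  obtain ss where ss: "set ss = S" "distinct ss" using finite_distinct_list[OF fin] by blast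
  define n where "n = length ss"
  have "\<exists>c::complex \<Rightarrow> int. x * s = (\<Sum>v\<in>S. of_int (c v) * v)" if "s \<in> S" for s
    using stable[OF that] by (auto simp: int_span.span_finite[OF fin])
  then obtain c :: "complex \<Rightarrow> complex \<Rightarrow> int"
    where c: "\<And>s. s \<in> S \<Longrightarrow> x * s = (\<Sum>v\<in>S. of_int (c s v) * v)" by metis
  \<comment> \<open>The integer matrix \<open>A\<close> provides the integer polynomial; its complex
    copy \<open>B\<close> is needed to speak of eigenvectors.\<close>
  define A where "A = mat n n (\<lambda>(i, j). c (ss ! i) (ss ! j))"
  define B where "B = map_mat (of_int :: int \<Rightarrow> complex) A"
  have A: "A \<in> carrier_mat n n" and B: "B \<in> carrier_mat n n" by (auto simp: A_def B_def)
  define v where "v = vec n (\<lambda>i. ss ! i)"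
  have "B *\<^sub>v v = x \<cdot>\<^sub>v v"
  proof (rule eq_vecI)
    fix i assume "i < dim_vec (x \<cdot>\<^sub>v v)"
    then have i: "i < n" by (simp add: v_def)
    have "(B *\<^sub>v v) $ i = (\<Sum>j=0..<n. of_int (c (ss ! i) (ss ! j)) * ss ! j)"
      using i by (auto simp: B_def A_def v_def scalar_prod_def intro!: sum.cong)
    also have "\<dots> = (\<Sum>w\<in>S. of_int (c (ss ! i) w) * w)"
      using ss by (intro sum.reindex_bij_betw[of "\<lambda>j. ss ! j"] bij_betw_nth) (auto simp: n_def)
    also have "\<dots> = x * ss ! i" using c[of "ss ! i"] i ss by (auto simp: n_def)
    finally show "(B *\<^sub>v v) $ i = (x \<cdot>\<^sub>v v) $ i" using i by (simp add: v_def)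
  qed (use B in \<open>auto simp: v_def\<close>)
  moreover have "v \<noteq> 0\<^sub>v n"
  proof
    assume v0: "v = 0\<^sub>v n"
    obtain i where i: "i < n" "ss ! i = s0" using nz ss by (auto simp: n_def in_set_conv_nth)
    have "v $ i = 0" using v0 i by simp
    with i nz show False by (simp add: v_def)
  qed
  ultimately have "eigenvector B v x"
    using B by (auto simp: eigenvector_def v_def)
  then have "poly (char_poly B) x = 0"
    using eigenvalue_root_char_poly[OF B] by (auto simp: eigenvalue_def)
  then have "poly (map_poly of_int (char_poly A)) x = 0"
    using of_int_hom.char_poly_hom[OF A, where ?'a = complex] by (simp add: B_def)
  moreover have "lead_coeff (char_poly A) = 1"
    using degree_monic_char_poly[OF A] by auto
  ultimately show ?thesis by (auto simp: algebraic_int_altdef_ipoly)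
qed

text \<open>Multiplication by \<open>x\<close> is additive, so it suffices to test it on
  generators.\<close>

lemma int_span_mult_left:
  assumes "y \<in> int_span.span S" and "\<And>s. s \<in> S \<Longrightarrow> x * s \<in> int_span.span T"
  shows "x * y \<in> int_span.span T"
  using assms(1)
proof (induction rule: int_span.span_induct_alt)
  case base
  then show ?case using int_span.span_zero by simp
next
  case (step c s y)
  have "of_int c * (x * s) + x * y \<in> int_span.span T"
    using step assms(2) by (intro int_span.span_add int_span.span_scale)
  then show ?case by (simp add: algebra_simps)
qed

text \<open>A monic integer equation for \<open>x\<close> is solved for its top power. The degree is
  positive because a monic constant is 1 and has no root.\<close>

lemma algebraic_int_power_in_span:
  assumes "algebraic_int (x::complex)"
  obtains m where "m > 0" "x ^ m \<in> int_span.span ((\<lambda>i. x ^ i) ` {..<m})"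
proof -
  obtain p where p: "poly (map_poly of_int p) x = 0" "lead_coeff p = 1"
    using assms by (auto simp: algebraic_int_altdef_ipoly)
  define m where "m = degree p"
  have m: "m > 0"
  proof (rule ccontr)
    assume "\<not> m > 0"
    then have "p = 1" using p by (auto simp: m_def elim!: degree_eq_zeroE)
    with p show False by simp
  qed
  have "0 = (\<Sum>i\<le>m. of_int (coeff p i) * x ^ i)"
    using p by (simp add: poly_altdef coeff_map_poly degree_map_poly m_def)
  also have "\<dots> = x ^ m + (\<Sum>i<m. of_int (coeff p i) * x ^ i)"
    using p by (simp add: lessThan_Suc_atMost[symmetric] m_def)
  finally have "x ^ m = (\<Sum>i<m. of_int (- coeff p i) * x ^ i)"
    by (simp add: sum_negf eq_neg_iff_add_eq_0)
  also have "\<dots> \<in> int_span.span ((\<lambda>i. x ^ i) ` {..<m})"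
    by (intro int_span.span_sum int_span.span_scale int_span.span_base) auto
  finally show ?thesis using m that by blast
qed

text \<open>The span of the \<open>x ^ i * y ^ j\<close> with \<open>i < m\<close> and
  \<open>j < n\<close> contains 1 and is stable under multiplication by \<open>x * y\<close>, so the
  determinant trick applies.\<close>

lemma algebraic_int_times:
  assumes "algebraic_int (x::complex)" "algebraic_int y"
  shows "algebraic_int (x * y)"
proof -
  obtain m where m: "m > 0" "x ^ m \<in> int_span.span ((\<lambda>i. x ^ i) ` {..<m})"
    using algebraic_int_power_in_span[OF assms(1)] .
  obtain n where n: "n > 0" "y ^ n \<in> int_span.span ((\<lambda>i. y ^ i) ` {..<n})"
    using algebraic_int_power_in_span[OF assms(2)] .
  define S where "S = (\<lambda>(i, j). x ^ i * y ^ j) ` ({..<m} \<times> {..<n})"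
  have S: "x ^ i * y ^ j \<in> int_span.span S" if "i < m" "j < n" for i j
    using that by (intro int_span.span_base) (auto simp: S_def)
  \<comment> \<open>Multiplication by \<open>x * y\<close> raises each exponent by one only, so the
    border values \<open>i = m\<close> and \<open>j = n\<close> are all that must be added. They are
    added one variable at a time.\<close>
  have x_step: "x ^ i * y ^ j \<in> int_span.span S" if "i \<le> m" "j < n" for i j
  proof (cases "i = m")
    case True
    have "y ^ j * x ^ m \<in> int_span.span S"
      using m(2) by (rule int_span_mult_left) (use S that in \<open>auto simp: mult.commute\<close>)
    then show ?thesis using True by (simp add: mult.commute)
  qed (use S that in auto)
  have xy_step: "x ^ i * y ^ j \<in> int_span.span S" if "i \<le> m" "j \<le> n" for i j
  proof (cases "j = n")
    case True
    have "x ^ i * y ^ n \<in> int_span.span S"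
      using n(2) by (rule int_span_mult_left) (use x_step that in auto)
    then show ?thesis using True by simp
  qed (use x_step that in auto)
  show ?thesis
  proof (rule algebraic_int_if_int_span_stable)
    show "1 \<in> S" using m n by (auto simp: S_def intro!: rev_image_eqI[of "(0, 0)"])
    fix s assume "s \<in> S"
    then obtain i j where s: "s = x ^ i * y ^ j" "i < m" "j < n" by (auto simp: S_def)
    then show "x * y * s \<in> int_span.span S"
      using xy_step[of "Suc i" "Suc j"] by (simp add: mult_ac)
  qed (auto simp: S_def)
qed

lemma algebraic_int_prod:
  assumes "\<And>i. i \<in> A \<Longrightarrow> algebraic_int (f i :: complex)"
  shows "algebraic_int (\<Prod>i\<in>A. f i)"
  using assms by (induction A rule: infinite_finite_induct) (auto intro: algebraic_int_times)

section \<open>Algebraic integers from the leading and constant coefficients\<close>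

text \<open>With \<open>c\<close> the leading coefficient and \<open>d\<close> the degree,
  \<open>c ^ (d - 1) * p(x)\<close> is a monic integer polynomial in \<open>c * x\<close>.\<close>

lemma algebraic_int_lead_coeff_times_root:
  fixes p :: "int poly" and x :: complex
  assumes "p \<noteq> 0" and root: "poly (map_poly of_int p) x = 0"
  shows "algebraic_int (of_int (lead_coeff p) * x)"
proof -
  define c d where "c = lead_coeff p" and "d = degree p"
  have d: "d > 0"
  proof (rule ccontr)
    assume "\<not> d > 0"
    then obtain k where "p = [:k:]" by (auto simp: d_def elim!: degree_eq_zeroE)
    with assms show False by (simp add: map_poly_pCons)
  qed
  \<comment> \<open>\<open>r\<close> holds the terms below the top one, chosen so that
    \<open>q(c * x) = c ^ (d - 1) * p(x)\<close>. The subtraction in the exponent is exact since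
    \<open>i < d\<close>.\<close>
  define r where "r = (\<Sum>i<d. monom (coeff p i * c ^ (d - 1 - i)) i)"
  define q where "q = monom 1 d + r"
  have coeff_r: "coeff r k = 0" if "k \<ge> d" for k
    using that by (simp add: r_def coeff_sum)
  have deg_q: "degree q = d"
    by (rule antisym) (auto simp: q_def coeff_r intro!: degree_le le_degree)
  have map_q: "map_poly of_int q = monom 1 d + (\<Sum>i<d. monom (of_int (coeff p i * c ^ (d - 1 - i))) i)"
    by (intro poly_eqI) (simp add: coeff_map_poly q_def r_def coeff_sum if_distrib cong: if_cong)
  have "poly (map_poly of_int q) (of_int c * x) =
          (of_int c * x) ^ d + (\<Sum>i<d. of_int (coeff p i * c ^ (d - 1 - i)) * (of_int c * x) ^ i)"
    unfolding map_q by (simp add: poly_monom poly_sum)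
  also have "(\<Sum>i<d. of_int (coeff p i * c ^ (d - 1 - i)) * (of_int c * x) ^ i) =
               (\<Sum>i<d. of_int c ^ (d - 1) * (of_int (coeff p i) * x ^ i))"
  proof (intro sum.cong refl)
    fix i assume "i \<in> {..<d}"
    then have "(of_int c :: complex) ^ (d - 1 - i) * of_int c ^ i = of_int c ^ (d - 1)"
      by (simp add: power_add[symmetric])
    then show "of_int (coeff p i * c ^ (d - 1 - i)) * (of_int c * x) ^ i =
                 of_int c ^ (d - 1) * (of_int (coeff p i) * x ^ i)"
      by (simp add: power_mult_distrib mult_ac)
  qed
  also have "(of_int c * x) ^ d = of_int c ^ (d - 1) * (of_int (coeff p d) * x ^ d)"
    using d by (cases d) (auto simp: c_def d_def power_mult_distrib)
  also have "\<dots> + (\<Sum>i<d. of_int c ^ (d - 1) * (of_int (coeff p i) * x ^ i)) =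
               of_int c ^ (d - 1) * (\<Sum>i\<le>d. of_int (coeff p i) * x ^ i)"
    by (simp add: lessThan_Suc_atMost[symmetric] sum_distrib_left algebra_simps)
  also have "(\<Sum>i\<le>d. of_int (coeff p i) * x ^ i) = poly (map_poly of_int p) x"
    by (simp add: poly_altdef coeff_map_poly degree_map_poly d_def)
  finally have "poly (map_poly of_int q) (of_int c * x) = 0" using root by simp
  moreover have "lead_coeff q = 1" unfolding deg_q by (simp add: q_def coeff_r)
  ultimately show ?thesis by (auto simp: algebraic_int_altdef_ipoly c_def)
qed

text \<open>The reversed polynomial has the root \<open>inverse x\<close>, and its leading
  coefficient is the constant coefficient of \<open>p\<close>.\<close>

lemma algebraic_int_const_coeff_div_root:
  fixes p :: "int poly" and x :: complex
  assumes "coeff p 0 \<noteq> 0" and root: "poly (map_poly of_int p) x = 0"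
  shows "algebraic_int (of_int (coeff p 0) * inverse x)"
proof -
  have "x \<noteq> 0" using assms by (auto simp: poly_0_coeff_0 coeff_map_poly)
  have "map_poly of_int (reflect_poly p) = reflect_poly (map_poly of_int p :: complex poly)"
    by (intro poly_eqI) (simp add: coeff_map_poly coeff_reflect_poly degree_map_poly)
  then have "poly (map_poly of_int (reflect_poly p)) (inverse x) = 0"
    using root \<open>x \<noteq> 0\<close> by (simp add: poly_reflect_poly_nz)
  then have "algebraic_int (of_int (lead_coeff (reflect_poly p)) * inverse x)"
    using assms by (intro algebraic_int_lead_coeff_times_root) auto
  moreover have "lead_coeff (reflect_poly p) = coeff p 0"
    using assms by (simp add: coeff_reflect_poly degree_reflect_poly_eq)
  ultimately show ?thesis by simp
qed

section \<open>Divisibility of products\<close>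

text \<open>By induction on \<open>A\<close>: \<open>division_decomp\<close> splits \<open>a\<close>
  into a divisor of the new factor and a divisor of the remaining product.\<close>

lemma dvd_prod_decomp:
  fixes a :: nat
  assumes "finite A" "a dvd (\<Prod>i\<in>A. c i)"
  shows "\<exists>f. a = (\<Prod>i\<in>A. f i) \<and> (\<forall>i\<in>A. f i dvd c i)"
  using assms
proof (induction A arbitrary: a rule: finite_induct)
  case (insert j A)
  then have "a dvd c j * (\<Prod>i\<in>A. c i)" by simp
  then obtain u v where uv: "a = u * v" "u dvd c j" "v dvd (\<Prod>i\<in>A. c i)"
    using division_decomp by blast
  then obtain f where f: "v = (\<Prod>i\<in>A. f i)" "\<forall>i\<in>A. f i dvd c i" using insert.IH by blast
  have "(\<Prod>i\<in>A. (f(j := u)) i) = (\<Prod>i\<in>A. f i)"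
    using insert.hyps by (intro prod.cong) auto
  then show ?case
    using insert.hyps uv f by (intro exI[of _ "f(j := u)"]) auto
qed auto

text \<open>The product of the numbers \<open>c n * f n\<close> is both rational and an algebraic
  integer, hence an integer; coprimality then moves \<open>b\<close> into the product of the
  \<open>c n\<close>. This serves both for the \<beta>'s with leading coefficients and for their
  inverses with constant coefficients.\<close>

lemma prod_dvd_if_algebraic_int:
  fixes f :: "nat \<Rightarrow> complex" and c :: "nat \<Rightarrow> int" and a b :: int
  assumes "finite A" and "\<And>n. n \<in> A \<Longrightarrow> algebraic_int (of_int (c n) * f n)"
    and "(\<Prod>n\<in>A. f n) = of_int a / of_int b" and "coprime a b" and "b \<noteq> 0"
  shows "b dvd (\<Prod>n\<in>A. c n)"
proof -
  have "algebraic_int (\<Prod>n\<in>A. of_int (c n) * f n)"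
    using assms(2) by (rule algebraic_int_prod)
  also have "(\<Prod>n\<in>A. of_int (c n) * f n) = of_int ((\<Prod>n\<in>A. c n) * a) / of_int b"
    using assms(3) by (simp add: prod.distrib)
  finally have "of_int ((\<Prod>n\<in>A. c n) * a) / of_int b \<in> (\<int> :: complex set)"
    by (rule rational_algebraic_int_is_int) (intro Rats_divide Rats_of_int)
  then obtain k where "of_int ((\<Prod>n\<in>A. c n) * a) / of_int b = (of_int k :: complex)"
    by (elim Ints_cases)
  then have "(of_int ((\<Prod>n\<in>A. c n) * a) :: complex) = of_int (k * b)"
    using assms(5) by (simp add: field_simps)
  then have "(\<Prod>n\<in>A. c n) * a = k * b" by (simp only: of_int_eq_iff)
  then have "b dvd (\<Prod>n\<in>A. c n) * a" by simp
  then show ?thesis using assms(4) by (simp add: coprime_dvd_mult_left_iff coprime_commute)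
qed

section \<open>Lower bounds for the Mahler measure\<close>

lemma cmod_prod_mset_le_exp_ln_plus:
  "cmod (prod_mset M) \<le> exp (\<Sum>\<beta>\<in>#M. ln_plus (cmod \<beta>))"
proof (induction M)
  case (add x M)
  have "cmod x \<le> exp (ln_plus (cmod x))"
  proof (cases "x = 0")
    case False
    have "cmod x = exp (ln (cmod x))" using False by simp
    also have "\<dots> \<le> exp (ln_plus (cmod x))" by (simp add: ln_plus_def)
    finally show ?thesis .
  qed simp
  then have "cmod x * cmod (prod_mset M) \<le>
     exp (ln_plus (cmod x)) * exp (\<Sum>\<beta>\<in>#M. ln_plus (cmod \<beta>))"
    using add by (intro mult_mono) auto
  then show ?case by (simp add: norm_mult exp_add)
qed simp

lemma ln_lead_coeff_le_mahler_poly: "ln (cmod (lead_coeff f)) \<le> mahler_poly f"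
proof -
  have "0 \<le> (\<Sum>\<beta>\<in>#M. ln_plus (cmod \<beta>))" for M
    by (induction M) (auto simp: ln_plus_def)
  then show ?thesis by (simp add: mahler_poly_def)
qed

text \<open>By Vieta, the constant coefficient is the leading coefficient times the product of the
  negated roots, and each root has modulus at most the exponential of its \<open>ln_plus\<close>
  term.\<close>

lemma ln_const_coeff_le_mahler_poly:
  assumes "coeff f 0 \<noteq> 0"
  shows "ln (cmod (coeff f 0)) \<le> mahler_poly f"
proof -
  let ?S = "\<Sum>\<beta>\<in>#proots f. ln_plus (cmod \<beta>)"
  have f0: "f \<noteq> 0" using assms by auto
  have "cmod (\<Prod>x\<in>#M. - x) = cmod (prod_mset M)" for M :: "complex multiset"
    by (induction M) (auto simp: norm_mult)
  moreover have "coeff f 0 = lead_coeff f * (\<Prod>x\<in>#proots f. - x)"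
  proof -
    have "poly (\<Prod>x\<in>#M. [:- x, 1:]) 0 = (\<Prod>x\<in>#M. - x)" for M :: "complex multiset"
      by (induction M) auto
    then have "poly (Polynomial.smult (lead_coeff f) (\<Prod>x\<in>#proots f. [:- x, 1:])) 0 =
                 lead_coeff f * (\<Prod>x\<in>#proots f. - x)" by simp
    then show ?thesis by (simp only: complex_poly_decompose_multiset poly_0_coeff_0)
  qed
  ultimately have "cmod (coeff f 0) = cmod (lead_coeff f) * cmod (prod_mset (proots f))"
    by (simp add: norm_mult)
  also have "\<dots> \<le> cmod (lead_coeff f) * exp ?S"
    by (intro mult_left_mono cmod_prod_mset_le_exp_ln_plus) auto
  finally have "ln (cmod (coeff f 0)) \<le> ln (cmod (lead_coeff f) * exp ?S)"
    using assms f0 by (subst ln_le_cancel_iff) auto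
  also have "\<dots> = mahler_poly f"
    using f0 by (subst ln_mult) (auto simp: mahler_poly_def)
  finally show ?thesis .
qed

text \<open>Otherwise \<open>X\<close> divides the irreducible minimal polynomial, which is then a
  constant multiple of \<open>X\<close> and has only the root 0.\<close>

lemma coeff_0_min_int_poly_nonzero:
  assumes "algebraic \<beta>" "\<beta> \<noteq> 0"
  shows "coeff (min_int_poly \<beta>) 0 \<noteq> 0"
proof
  assume 0: "coeff (min_int_poly \<beta>) 0 = 0"
  have p: "irreducible (min_int_poly \<beta>)" "poly (map_poly of_int (min_int_poly \<beta>)) \<beta> = 0"
    using min_int_poly[OF assms(1)] by (auto simp: is_min_int_poly_def)
  obtain q where q: "min_int_poly \<beta> = [:0, 1:] * q"
    using 0 by (cases "min_int_poly \<beta>") auto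
  have "is_unit [:0, 1::int:] \<or> is_unit q"
    using p(1) unfolding q by (rule irreducibleD) (rule refl)
  then have "is_unit q" by (auto simp: is_unit_poly_iff)
  then obtain k where "q = [:k:]" "k \<noteq> 0" by (auto simp: is_unit_poly_iff)
  with p(2) q assms(2) show False by (simp add: map_poly_pCons)
qed

lemma ln_lead_coeff_le_mahler:
  "ln (real_of_int \<bar>lead_coeff (min_int_poly \<beta>)\<bar>) \<le> mahler \<beta>"
  using ln_lead_coeff_le_mahler_poly[of "map_poly of_int (min_int_poly \<beta>)"]
  by (simp add: mahler_def coeff_map_poly degree_map_poly)

lemma ln_const_coeff_le_mahler:
  assumes "algebraic \<beta>" "\<beta> \<noteq> 0"
  shows "ln (real_of_int \<bar>coeff (min_int_poly \<beta>) 0\<bar>) \<le> mahler \<beta>"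
  using ln_const_coeff_le_mahler_poly[of "map_poly of_int (min_int_poly \<beta>)"]
    coeff_0_min_int_poly_nonzero[OF assms]
  by (simp add: mahler_def coeff_map_poly)

section \<open>The Mahler measure of a rational number\<close>

text \<open>In any factorization one factor is constant by degree; this constant divides both
  coefficients and is therefore a unit.\<close>

lemma irreducible_coprime_linear_poly:
  fixes a b :: int
  assumes "coprime a b" "b \<noteq> 0"
  shows "irreducible [:a, b:]"
proof (rule irreducibleI)
  show "\<not> is_unit [:a, b:]" using assms by (auto simp: is_unit_poly_iff)
  have const_unit: "is_unit [:c:]" if "[:c:] dvd [:a, b:]" for c
  proof -
    have "c dvd coeff [:a, b:] i" for i using that by (simp only: const_poly_dvd_iff)
    from this[of 0] this[of 1] have "c dvd a" "c dvd b" by simp_all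
    then have "is_unit c" using assms(1) coprime_common_divisor by blast
    then show ?thesis by (simp add: is_unit_const_poly_iff)
  qed
  fix p q assume pq: "[:a, b:] = p * q"
  then have "p \<noteq> 0" "q \<noteq> 0" using assms by auto
  then have "degree p + degree q = degree [:a, b:]" using pq by (simp add: degree_mult_eq)
  then have "degree p = 0 \<or> degree q = 0" using assms by auto
  then show "is_unit p \<or> is_unit q"
  proof
    assume "degree p = 0"
    then obtain c where "p = [:c:]" by (auto elim: degree_eq_zeroE)
    then show ?thesis using const_unit[of c] pq by (metis dvd_triv_left)
  next
    assume "degree q = 0"
    then obtain c where "q = [:c:]" by (auto elim: degree_eq_zeroE)
    then show ?thesis using const_unit[of c] pq by (metis dvd_triv_right)
  qed
qed (use assms in auto)

lemma algebraic_of_int_div: "algebraic (of_int a / of_int b :: complex)"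
proof (cases "b = 0")
  case False
  then have "poly [:- of_int a, of_int b:] (of_int a / of_int b :: complex) = 0" by simp
  moreover have "\<forall>i. coeff [:- of_int a, of_int b :: complex:] i \<in> \<int>"
    by (auto simp: coeff_pCons split: nat.splits)
  ultimately show ?thesis
    using False by (intro algebraicI[of "[:- of_int a, of_int b:]"]) auto
qed auto

text \<open>The minimal polynomial is \<open>b X - a\<close>, so the measure is \<open>ln b\<close>
  plus \<open>ln_plus\<close> of \<open>\<bar>a\<bar> / b\<close>.\<close>

lemma mahler_of_int_div:
  fixes a b :: int
  assumes "coprime a b" "a \<noteq> 0" "b > 0"
  shows "mahler (of_int a / of_int b) = ln (real_of_int (max \<bar>a\<bar> b))"
proof -
  let ?x = "of_int a / of_int b :: complex"
  have "is_min_int_poly ?x [:- a, b:]"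
    unfolding is_min_int_poly_def using assms
    by (intro conjI irreducible_coprime_linear_poly) (auto simp: map_poly_pCons)
  then have "min_int_poly ?x = [:- a, b:]"
    using ex1_is_min_int_poly[OF algebraic_of_int_div[of a b]] min_int_poly[OF algebraic_of_int_div[of a b]]
    by blast
  moreover have "map_poly of_int [:- a, b:] = Polynomial.smult (of_int b) [:- ?x, 1:]"
    using assms by (simp add: map_poly_pCons)
  ultimately have "mahler ?x = mahler_poly (Polynomial.smult (of_int b) [:- ?x, 1:])"
    by (simp add: mahler_def)
  also have "\<dots> = ln (real_of_int b) + ln_plus (cmod ?x)"
    using assms by (simp add: mahler_poly_def del: smult_pCons)
  also have "cmod ?x = real_of_int \<bar>a\<bar> / real_of_int b"
    using assms by (simp add: norm_divide)
  also have "ln (real_of_int b) + ln_plus (real_of_int \<bar>a\<bar> / real_of_int b) =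
               max (ln (real_of_int \<bar>a\<bar>)) (ln (real_of_int b))"
    using assms by (simp add: ln_plus_def ln_div max_def)
  also have "\<dots> = ln (real_of_int (max \<bar>a\<bar> b))"
    using assms by (auto simp: max_def)
  finally show ?thesis .
qed

section \<open>From algebraic to rational factorizations\<close>

lemma int_dvd_prod_imp_dvd_prod_nat_abs:
  assumes "int a dvd (\<Prod>n\<in>A. c n)"
  shows "a dvd (\<Prod>n\<in>A. nat \<bar>c n\<bar>)"
proof -
  have "int a dvd \<bar>\<Prod>n\<in>A. c n\<bar>" using assms by simp
  also have "\<bar>\<Prod>n\<in>A. c n\<bar> = int (\<Prod>n\<in>A. nat \<bar>c n\<bar>)" by (simp add: abs_prod)
  finally show ?thesis by (simp only: int_dvd_int_iff)
qed

lemma factorization_dominates_splitting: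
  fixes a b :: nat and s :: int
  assumes fact: "is_factorization \<alpha> N \<beta>"
    and \<alpha>: "\<alpha> = of_int (s * int a) / of_int (int b)"
    and s: "\<bar>s\<bar> = 1" and ab: "coprime a b" "a > 0" "b > 0"
  obtains x y :: "nat \<Rightarrow> nat"
  where "(\<Prod>n=1..N. x n) = a" "(\<Prod>n=1..N. y n) = b"
    "\<And>n. n \<in> {1..N} \<Longrightarrow> ln (real (max (x n) (y n))) \<le> mahler (\<beta> n)"
proof -
  define p where "p n = min_int_poly (\<beta> n)" for n
  have \<beta>: "algebraic (\<beta> n)" "\<beta> n \<noteq> 0" if "n \<in> {1..N}" for n
    using fact that by (auto simp: is_factorization_def)
  have prod_\<beta>: "(\<Prod>n=1..N. \<beta> n) = \<alpha>" using fact by (simp add: is_factorization_def)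
  have root: "poly (map_poly of_int (p n)) (\<beta> n) = 0" and lead: "lead_coeff (p n) > 0"
    if "n \<in> {1..N}" for n
    using min_int_poly[OF \<beta>(1)[OF that]] by (auto simp: p_def is_min_int_poly_def)
  have const: "coeff (p n) 0 \<noteq> 0" if "n \<in> {1..N}" for n
    using coeff_0_min_int_poly_nonzero \<beta> that by (auto simp: p_def)
  have s': "s = 1 \<or> s = - 1" using s by auto

  have "int b dvd (\<Prod>n=1..N. lead_coeff (p n))"
  proof (rule prod_dvd_if_algebraic_int[where f = \<beta> and a = "s * int a"])
    show "algebraic_int (of_int (lead_coeff (p n)) * \<beta> n)" if "n \<in> {1..N}" for n
      using root[OF that] lead[OF that] by (intro algebraic_int_lead_coeff_times_root) auto
  qed (use prod_\<beta> \<alpha> ab s' in auto)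
  then obtain y where y: "b = (\<Prod>n=1..N. y n)" "\<And>n. n \<in> {1..N} \<Longrightarrow> y n dvd nat \<bar>lead_coeff (p n)\<bar>"
    using dvd_prod_decomp[OF _ int_dvd_prod_imp_dvd_prod_nat_abs] by blast

  have "int a dvd (\<Prod>n=1..N. coeff (p n) 0)"
  \<comment> \<open>The same argument for the inverse of \<alpha>; the sign \<open>s\<close> is its
    own inverse and so stays in the numerator.\<close>
  proof (rule prod_dvd_if_algebraic_int[where f = "\<lambda>n. inverse (\<beta> n)" and a = "s * int b"])
    show "algebraic_int (of_int (coeff (p n) 0) * inverse (\<beta> n))" if "n \<in> {1..N}" for n
      using const[OF that] root[OF that] by (rule algebraic_int_const_coeff_div_root)
    have "(\<Prod>n=1..N. inverse (\<beta> n)) = inverse \<alpha>" using prod_\<beta> prod_inversef[of \<beta> "{1..N}"] by (simp add: o_def)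
    then show "(\<Prod>n=1..N. inverse (\<beta> n)) = of_int (s * int b) / of_int (int a)"
      using s' by (auto simp: \<alpha>)
  qed (use ab s' in \<open>auto simp: coprime_commute\<close>)
  then obtain x where x: "a = (\<Prod>n=1..N. x n)" "\<And>n. n \<in> {1..N} \<Longrightarrow> x n dvd nat \<bar>coeff (p n) 0\<bar>"
    using dvd_prod_decomp[OF _ int_dvd_prod_imp_dvd_prod_nat_abs] by blast

  have "ln (real (max (x n) (y n))) \<le> mahler (\<beta> n)" if n: "n \<in> {1..N}" for n
  proof -
    have "x n \<noteq> 0" "y n \<noteq> 0" using x(1) y(1) ab n by (auto simp del: One_nat_def)
    have "x n \<le> nat \<bar>coeff (p n) 0\<bar>" "y n \<le> nat \<bar>lead_coeff (p n)\<bar>"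
      using x(2)[OF n] y(2)[OF n] const[OF n] lead[OF n] by (auto intro!: dvd_imp_le)
    then have "real (x n) \<le> real_of_int \<bar>coeff (p n) 0\<bar>" "real (y n) \<le> real_of_int \<bar>lead_coeff (p n)\<bar>"
      by linarith+
    then have "ln (real (x n)) \<le> ln (real_of_int \<bar>coeff (p n) 0\<bar>)"
      "ln (real (y n)) \<le> ln (real_of_int \<bar>lead_coeff (p n)\<bar>)"
      using \<open>x n \<noteq> 0\<close> \<open>y n \<noteq> 0\<close> by (auto intro!: ln_mono)
    then have "ln (real (x n)) \<le> mahler (\<beta> n)" "ln (real (y n)) \<le> mahler (\<beta> n)"
      using ln_const_coeff_le_mahler[OF \<beta>[OF n]] ln_lead_coeff_le_mahler[of "\<beta> n"]
      by (auto simp: p_def)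
    then show ?thesis by (simp add: max_def)
  qed
  with x(1) y(1) show ?thesis using that by blast
qed

text \<open>As divisors of the coprime numbers \<open>a\<close> and \<open>b\<close>,
  \<open>x n\<close> and \<open>y n\<close> are coprime. So each quotient is in lowest terms and its
  measure is known exactly.\<close>

lemma splitting_gives_rational_factorization:
  fixes a b :: nat and s :: int and x y :: "nat \<Rightarrow> nat"
  assumes \<alpha>: "\<alpha> = of_int (s * int a) / of_int (int b)"
    and s: "\<bar>s\<bar> = 1" and ab: "coprime a b" "a > 0" "b > 0"
    and N: "N \<ge> 1" and xy: "(\<Prod>n=1..N. x n) = a" "(\<Prod>n=1..N. y n) = b"
  obtains c where "is_factorization \<alpha> N c"
    "\<And>n. n \<in> {1..N} \<Longrightarrow> c n \<in> \<rat> \<and> c n \<noteq> 0 \<and> mahler (c n) = ln (real (max (x n) (y n)))"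
proof -
  \<comment> \<open>The first factor carries the whole sign; it exists because
    \<open>N \<ge> 1\<close>.\<close>
  define e where "e n = (if n = 1 then s else 1)" for n :: nat
  define c :: "nat \<Rightarrow> complex" where "c n = of_int (e n * int (x n)) / of_int (int (y n))" for n
  have e: "\<bar>e n\<bar> = 1" for n using s by (simp add: e_def)
  have c: "c n \<in> \<rat> \<and> c n \<noteq> 0 \<and> mahler (c n) = ln (real (max (x n) (y n)))" if n: "n \<in> {1..N}" for n
  proof -
    have dvd: "x n dvd a" "y n dvd b" using n xy by (auto simp del: One_nat_def)
    then have pos: "x n > 0" "y n > 0" using ab by (auto intro!: Nat.gr0I)
    have "coprime (x n) (y n)" using dvd ab by (meson coprime_divisors)
    then have "coprime (e n * int (x n)) (int (y n))" using e[of n] by (auto simp: abs_if split: if_splits)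
    then have "mahler (c n) = ln (real_of_int (max \<bar>e n * int (x n)\<bar> (int (y n))))"
      unfolding c_def using pos e[of n] by (intro mahler_of_int_div) auto
    also have "max \<bar>e n * int (x n)\<bar> (int (y n)) = int (max (x n) (y n))"
      using e[of n] by (simp add: abs_mult)
    finally have "mahler (c n) = ln (real (max (x n) (y n)))" by simp
    moreover have "c n \<in> \<rat>" unfolding c_def by (intro Rats_divide Rats_of_int)
    moreover have "c n \<noteq> 0" using pos e[of n] by (auto simp: c_def)
    ultimately show ?thesis by blast
  qed
  have "(\<Prod>n=1..N. e n) = s" using N by (simp add: e_def prod.If_cases Int_absorb1)
  then have "(\<Prod>n=1..N. c n) = \<alpha>"
    using xy by (simp add: c_def \<alpha> prod.distrib prod_dividef flip: of_nat_prod of_int_prod)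
  moreover have "algebraic (c n)" for n unfolding c_def by (rule algebraic_of_int_div)
  ultimately have "is_factorization \<alpha> N c" using N c by (auto simp: is_factorization_def)
  then show ?thesis using c that by blast
qed

section \<open>Finiteness of the values on splittings\<close>

text \<open>A factor other than 1 is at least 2, and \<open>k < 2 ^ k\<close>.\<close>

lemma card_nontrivial_factors_le_prod:
  fixes f :: "'a \<Rightarrow> nat"
  assumes "finite A" "(\<Prod>n\<in>A. f n) > 0"
  shows "card {n\<in>A. f n \<noteq> 1} \<le> (\<Prod>n\<in>A. f n)"
proof -
  let ?B = "{n\<in>A. f n \<noteq> 1}"
  have "card ?B < 2 ^ card ?B" by (rule less_exp)
  also have "2 ^ card ?B = (\<Prod>n\<in>?B. 2 :: nat)" by simp
  also have "\<dots> \<le> (\<Prod>n\<in>?B. f n)"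
  proof (rule prod_mono)
    fix n assume "n \<in> ?B"
    moreover then have "f n \<noteq> 0" using assms by auto
    ultimately show "0 \<le> (2::nat) \<and> 2 \<le> f n" by auto
  qed
  also have "\<dots> = (\<Prod>n\<in>A. f n)" using assms(1) by (intro prod.mono_neutral_left) auto
  finally show ?thesis by simp
qed

text \<open>Pairs \<open>(1, 1)\<close> contribute 0, so a sum is determined by how often each other
  pair occurs. Only finitely many pairs are possible, and each occurs at most \<open>a + b\<close>
  times, however large \<open>N\<close> is.\<close>

lemma finite_splitting_sums:
  fixes a b :: nat and g :: "nat \<times> nat \<Rightarrow> real"
  assumes ab: "a > 0" "b > 0" and g: "g (1, 1) = 0"
  shows "finite {\<Sum>n=1..N. g (x n, y n) | N x y.
                   (\<Prod>n=1..N::nat. x n) = a \<and> (\<Prod>n=1..N. y n) = b}" (is "finite ?S")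
proof -
  define D where "D = {1..a} \<times> {1..b} - {(1, 1)}"
  have "v \<in> (\<lambda>h. \<Sum>d\<in>D. real (h d) * g d) ` (D \<rightarrow>\<^sub>E {..a + b})" if v: "v \<in> ?S" for v
  proof -
    obtain N :: nat and x y where v_eq: "v = (\<Sum>n=1..N. g (x n, y n))"
      and xy: "(\<Prod>n=1..N. x n) = a" "(\<Prod>n=1..N. y n) = b" using v by blast
    define I where "I = {n\<in>{1..N}. (x n, y n) \<noteq> (1, 1)}"
    have fin: "finite I" by (simp add: I_def)
    have "card I \<le> card ({n\<in>{1..N}. x n \<noteq> 1} \<union> {n\<in>{1..N}. y n \<noteq> 1})"
      by (rule card_mono) (auto simp: I_def)
    also have "\<dots> \<le> card {n\<in>{1..N}. x n \<noteq> 1} + card {n\<in>{1..N}. y n \<noteq> 1}" by (rule card_Un_le)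
    also have "\<dots> \<le> a + b"
      using card_nontrivial_factors_le_prod[of "{1..N}" x] card_nontrivial_factors_le_prod[of "{1..N}" y]
        xy ab by (intro add_mono) auto
    finally have card_I: "card I \<le> a + b" .
    have D: "(x n, y n) \<in> D" if "n \<in> I" for n
    proof -
      have "x n dvd a" "y n dvd b" using that xy by (auto simp: I_def simp del: One_nat_def)
      then have "x n \<in> {1..a}" "y n \<in> {1..b}"
        using ab by (auto intro: dvd_imp_le intro!: Suc_leI Nat.gr0I)
      then show ?thesis using that by (auto simp: D_def I_def)
    qed
    \<comment> \<open>\<open>h\<close> counts the occurrences of each pair; restricting it to
      \<open>D\<close> puts it into a finite function space.\<close>
    define h where "h = restrict (\<lambda>d. card {n\<in>I. (x n, y n) = d}) D"
    have "v = (\<Sum>n\<in>I. g (x n, y n))"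
      unfolding v_eq using g by (intro sum.mono_neutral_right) (auto simp: I_def)
    also have "\<dots> = (\<Sum>d\<in>D. \<Sum>n\<in>{n\<in>I. (x n, y n) = d}. g (x n, y n))"
      using fin D by (intro sum.group[symmetric]) (auto simp: D_def)
    also have "\<dots> = (\<Sum>d\<in>D. real (h d) * g d)"
    proof (rule sum.cong)
      fix d assume d: "d \<in> D"
      have "(\<Sum>n\<in>{n\<in>I. (x n, y n) = d}. g (x n, y n)) = (\<Sum>n\<in>{n\<in>I. (x n, y n) = d}. g d)"
        by (rule sum.cong) auto
      then show "(\<Sum>n\<in>{n\<in>I. (x n, y n) = d}. g (x n, y n)) = real (h d) * g d"
        using d by (simp add: h_def)
    qed simp
    finally have "v = (\<Sum>d\<in>D. real (h d) * g d)" .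
    moreover have "h \<in> D \<rightarrow>\<^sub>E {..a + b}"
      by (auto simp: h_def intro!: order.trans[OF card_mono[OF fin] card_I])
    ultimately show ?thesis by blast
  qed
  moreover have "finite (D \<rightarrow>\<^sub>E {..a + b})" by (intro finite_PiE) (auto simp: D_def)
  ultimately show ?thesis by (meson finite_imageI finite_subset subsetI)
qed

section \<open>Attainment of the infimum\<close>

text \<open>The functional \<open>F\<close> stands for either the t-th power mean expression or the
  maximum, so that both cases share one argument. The least value over splittings of
  \<open>a\<close> and \<open>b\<close> is realized by a rational factorization and, by
  monotonicity, bounds the value of every algebraic one from below.\<close>

lemma rational_factorization_attains_Inf:
  fixes F :: "nat \<Rightarrow> (nat \<Rightarrow> real) \<Rightarrow> real" and a b :: nat and s :: int
  assumes \<alpha>: "\<alpha> = of_int (s * int a) / of_int (int b)"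
    and s: "\<bar>s\<bar> = 1" and ab: "coprime a b" "a > 0" "b > 0"
    and mono: "\<And>N m m'. N \<ge> 1 \<Longrightarrow> (\<And>n. n \<in> {1..N} \<Longrightarrow> 0 \<le> m n \<and> m n \<le> m' n) \<Longrightarrow> F N m \<le> F N m'"
    and fin: "finite {F N (\<lambda>n. ln (real (max (x n) (y n)))) | N x y.
                N \<ge> 1 \<and> (\<Prod>n=1..N. x n) = a \<and> (\<Prod>n=1..N. y n) = b}" (is "finite ?W")
  shows "\<exists>N c. N \<ge> 1 \<and> (\<forall>n\<in>{1..N}. c n \<in> \<rat> \<and> c n \<noteq> 0) \<and> \<alpha> = (\<Prod>n=1..N. c n) \<and>
           Inf {F N (\<lambda>n. mahler (\<beta> n)) | N \<beta>. is_factorization \<alpha> N \<beta>} = F N (\<lambda>n. mahler (c n))"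
    (is "\<exists>N c. _ \<and> _ \<and> _ \<and> Inf ?V = _")
proof -
  have ln_nonneg: "0 \<le> ln (real (max (x n) (y n)))"
    if "(\<Prod>n=1..N. x n) = a" "n \<in> {1..N}" for x y :: "nat \<Rightarrow> nat" and n N :: nat
  proof -
    have "x n \<noteq> 0" using that ab by (auto simp del: One_nat_def)
    then show ?thesis by simp
  qed
  \<comment> \<open>The splitting into the single quotient \<open>a / b\<close> shows that the set
    of values is nonempty.\<close>
  have "F 1 (\<lambda>n. ln (real (max ((\<lambda>_. a) n) ((\<lambda>_. b) n)))) \<in> ?W"
    by (intro CollectI exI[of _ 1] exI[of _ "\<lambda>_. a"] exI[of _ "\<lambda>_. b"]) auto
  then have "Min ?W \<in> ?W" using fin by (intro Min_in) auto
  then obtain N x y where Nxy: "N \<ge> 1" "(\<Prod>n=1..N. x n) = a" "(\<Prod>n=1..N. y n) = b"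
    and Min_eq: "Min ?W = F N (\<lambda>n. ln (real (max (x n) (y n))))" by blast
  obtain c where c: "is_factorization \<alpha> N c"
    "\<And>n. n \<in> {1..N} \<Longrightarrow> c n \<in> \<rat> \<and> c n \<noteq> 0 \<and> mahler (c n) = ln (real (max (x n) (y n)))"
    using splitting_gives_rational_factorization[OF \<alpha> s ab Nxy] by blast
  \<comment> \<open>The two arguments of \<open>F\<close> agree only on \<open>{1..N}\<close>;
    monotonicity in both directions shows that \<open>F\<close> sees no other indices.\<close>
  have F_c: "F N (\<lambda>n. mahler (c n)) = Min ?W"
    unfolding Min_eq using c(2) ln_nonneg[OF Nxy(2)] Nxy(1) by (intro antisym mono) auto
  have "Inf ?V = Min ?W"
  proof (rule cInf_eq_minimum)
    show "Min ?W \<in> ?V" using c(1) F_c by force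
    fix v assume "v \<in> ?V"
    then obtain N' \<beta> where v: "v = F N' (\<lambda>n. mahler (\<beta> n))" and fact: "is_factorization \<alpha> N' \<beta>" by blast
    have N': "N' \<ge> 1" using fact by (simp add: is_factorization_def)
    obtain x' y' where xy': "(\<Prod>n=1..N'. x' n) = a" "(\<Prod>n=1..N'. y' n) = b"
      "\<And>n. n \<in> {1..N'} \<Longrightarrow> ln (real (max (x' n) (y' n))) \<le> mahler (\<beta> n)"
      using factorization_dominates_splitting[OF fact \<alpha> s ab] by blast
    have "F N' (\<lambda>n. ln (real (max (x' n) (y' n)))) \<in> ?W" using N' xy' by blast
    then have "Min ?W \<le> F N' (\<lambda>n. ln (real (max (x' n) (y' n))))" using fin by (rule Min_le[rotated])
    also have "\<dots> \<le> v"
      unfolding v using N' by (rule mono) (use ln_nonneg[OF xy'(1)] xy'(3) in auto)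
    finally show "Min ?W \<le> v" .
  qed
  then show ?thesis
    using Nxy(1) c F_c by (intro exI[of _ N] exI[of _ c]) (auto simp: is_factorization_def)
qed

theorem theorem1p2:
  fixes \<alpha> :: complex and t :: ereal
  assumes "\<alpha> \<in> \<rat>" and "\<alpha> \<noteq> 0" and "1 \<le> t"
  shows "\<exists>N (a :: nat \<Rightarrow> complex). N \<ge> 1 \<and> (\<forall>n\<in>{1..N}. a n \<in> \<rat> \<and> a n \<noteq> 0) \<and>
           \<alpha> = (\<Prod>n=1..N. a n) \<and>
           (t < \<infinity> \<longrightarrow> metric_mahler t \<alpha> =
              (\<Sum>n=1..N. mahler (a n) powr real_of_ereal t) powr (1 / real_of_ereal t)) \<and>
           (t = \<infinity> \<longrightarrow> metric_mahler t \<alpha> = Max ((\<lambda>n. mahler (a n)) ` {1..N}))"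
proof -
  obtain a' b' :: int where ab': "b' > 0" "coprime a' b'" "\<alpha> = of_int a' / of_int b'"
    using assms(1) by (auto elim: Rats_cases')
  define a b s where "a = nat \<bar>a'\<bar>" and "b = nat b'" and "s = sgn a'"
  have "a' \<noteq> 0" using ab' assms(2) by auto
  then have \<alpha>: "\<alpha> = of_int (s * int a) / of_int (int b)" and s: "\<bar>s\<bar> = 1" and ab: "a > 0" "b > 0"
    using ab' by (auto simp: a_def b_def s_def sgn_mult_abs abs_sgn_eq)
  have "coprime (int a) (int b)" using ab' by (simp add: a_def b_def)
  then have cop: "coprime a b" by simp
  show ?thesis
  proof (cases "t = \<infinity>")
    case True
    let ?F = "\<lambda>N (m :: nat \<Rightarrow> real). Max (m ` {1..N})"
    have "\<exists>N c. N \<ge> 1 \<and> (\<forall>n\<in>{1..N}. c n \<in> \<rat> \<and> c n \<noteq> 0) \<and> \<alpha> = (\<Prod>n=1..N. c n) \<and>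
            Inf {?F N (\<lambda>n. mahler (\<beta> n)) | N \<beta>. is_factorization \<alpha> N \<beta>} = ?F N (\<lambda>n. mahler (c n))"
    proof (rule rational_factorization_attains_Inf[where F = ?F, OF \<alpha> s cop ab])
      fix N and m m' :: "nat \<Rightarrow> real"
      assume N: "N \<ge> 1" and le: "\<And>n. n \<in> {1..N} \<Longrightarrow> 0 \<le> m n \<and> m n \<le> m' n"
      show "?F N m \<le> ?F N m'"
      proof (rule Max.boundedI)
        fix v assume "v \<in> m ` {1..N}"
        then obtain n where n: "n \<in> {1..N}" "v = m n" by blast
        then have "v \<le> m' n" using le by auto
        also have "\<dots> \<le> ?F N m'" using n by (intro Max_ge) auto
        finally show "v \<le> ?F N m'" .
      qed (use N in auto)
    next
      \<comment> \<open>A maximum is one of its entries, and an entry depends only on a pair of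
        divisors of \<open>a\<close> and \<open>b\<close>; no count of the factors is needed
        here.\<close>
      let ?G = "(\<lambda>(i, j). ln (real (max i j))) ` ({..a} \<times> {..b})"
      have in_G: "?F N (\<lambda>n. ln (real (max (x n) (y n)))) \<in> ?G"
        if "N \<ge> 1" "(\<Prod>n=1..N. x n) = a" "(\<Prod>n=1..N. y n) = b" for N and x y :: "nat \<Rightarrow> nat"
      proof -
        have "x n dvd a" "y n dvd b" if "n \<in> {1..N}" for n
          using that \<open>(\<Prod>n=1..N. x n) = a\<close> \<open>(\<Prod>n=1..N. y n) = b\<close> by (auto simp del: One_nat_def)
        then have "(x n, y n) \<in> {..a} \<times> {..b}" if "n \<in> {1..N}" for n
          using that ab by (auto intro: dvd_imp_le)
        then have "(\<lambda>n. ln (real (max (x n) (y n)))) ` {1..N} \<subseteq> ?G"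
          by (intro image_subsetI rev_image_eqI) (assumption, simp)
        moreover have "?F N (\<lambda>n. ln (real (max (x n) (y n)))) \<in> (\<lambda>n. ln (real (max (x n) (y n)))) ` {1..N}"
          using \<open>N \<ge> 1\<close> by (intro Max_in) auto
        ultimately show ?thesis by (rule subsetD)
      qed
      have "{?F N (\<lambda>n. ln (real (max (x n) (y n)))) | N x y.
          N \<ge> 1 \<and> (\<Prod>n=1..N. x n) = a \<and> (\<Prod>n=1..N. y n) = b} \<subseteq> ?G"
        by (rule subsetI, elim CollectE exE conjE) (simp only: in_G)
      then show "finite {?F N (\<lambda>n. ln (real (max (x n) (y n)))) | N x y.
          N \<ge> 1 \<and> (\<Prod>n=1..N. x n) = a \<and> (\<Prod>n=1..N. y n) = b}"
        by (rule finite_subset) simp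
    qed
    moreover have "metric_mahler t \<alpha> = Inf {?F N (\<lambda>n. mahler (\<beta> n)) | N \<beta>. is_factorization \<alpha> N \<beta>}"
      unfolding metric_mahler_def metric_mahler_infinity_def if_P[OF True] by (rule refl)
    ultimately obtain N c where "N \<ge> 1" "\<forall>n\<in>{1..N}. c n \<in> \<rat> \<and> c n \<noteq> 0" "\<alpha> = (\<Prod>n=1..N. c n)"
      "metric_mahler t \<alpha> = ?F N (\<lambda>n. mahler (c n))" by (elim exE conjE) (rule that, assumption+, erule trans)
    then show ?thesis using True by (intro exI[of _ N] exI[of _ c] conjI impI) simp_all
  next
    case False
    define r where "r = real_of_ereal t"
    have r: "r \<ge> 1" using False assms(3) by (cases t) (auto simp: r_def)
    let ?F = "\<lambda>N (m :: nat \<Rightarrow> real). (\<Sum>n=1..N. m n powr r) powr (1 / r)"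
    have "\<exists>N c. N \<ge> 1 \<and> (\<forall>n\<in>{1..N}. c n \<in> \<rat> \<and> c n \<noteq> 0) \<and> \<alpha> = (\<Prod>n=1..N. c n) \<and>
            Inf {?F N (\<lambda>n. mahler (\<beta> n)) | N \<beta>. is_factorization \<alpha> N \<beta>} = ?F N (\<lambda>n. mahler (c n))"
    proof (rule rational_factorization_attains_Inf[where F = ?F, OF \<alpha> s cop ab])
      fix N and m m' :: "nat \<Rightarrow> real"
      assume "\<And>n. n \<in> {1..N} \<Longrightarrow> 0 \<le> m n \<and> m n \<le> m' n"
      then show "?F N m \<le> ?F N m'"
        using r by (intro powr_mono2 sum_mono sum_nonneg) auto
    next
      let ?g = "\<lambda>(i, j). ln (real (max i j)) powr r"
      let ?S = "{\<Sum>n=1..N. ln (real (max (x n) (y n))) powr r | N x y. (\<Prod>n=1..N::nat. x n) = a \<and> (\<Prod>n=1..N. y n) = b}"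
      \<comment> \<open>The required value 0 at \<open>(1, 1)\<close> comes from
        \<open>ln 1 = 0\<close> and \<open>0 powr r = 0\<close>.\<close>
      have "finite ?S" using finite_splitting_sums[OF ab, of ?g] by simp
      then have "finite ((\<lambda>v. v powr (1 / r)) ` ?S)" by (rule finite_imageI)
      moreover have "{?F N (\<lambda>n. ln (real (max (x n) (y n)))) | N x y.
          N \<ge> 1 \<and> (\<Prod>n=1..N. x n) = a \<and> (\<Prod>n=1..N. y n) = b} \<subseteq> (\<lambda>v. v powr (1 / r)) ` ?S"
        by blast
      ultimately show "finite {?F N (\<lambda>n. ln (real (max (x n) (y n)))) | N x y.
          N \<ge> 1 \<and> (\<Prod>n=1..N. x n) = a \<and> (\<Prod>n=1..N. y n) = b}"
        by (rule finite_subset[rotated])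
    qed
    moreover have "metric_mahler t \<alpha> = Inf {?F N (\<lambda>n. mahler (\<beta> n)) | N \<beta>. is_factorization \<alpha> N \<beta>}"
      unfolding metric_mahler_def metric_mahler_real_def if_not_P[OF False] r_def by (rule refl)
    ultimately obtain N c where "N \<ge> 1" "\<forall>n\<in>{1..N}. c n \<in> \<rat> \<and> c n \<noteq> 0" "\<alpha> = (\<Prod>n=1..N. c n)"
      "metric_mahler t \<alpha> = ?F N (\<lambda>n. mahler (c n))" by (elim exE conjE) (rule that, assumption+, erule trans)
    then show ?thesis using False by (intro exI[of _ N] exI[of _ c] conjI impI) (simp_all add: r_def)
  qed
qed

end
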